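(* Let $a,b>0$ and $0<t,\tau<1$. If $t\leq r(\tau)$ or $t\geq R(\tau)$, then $$!_{t}(a,b)\left(\frac{a\nabla b}{!_{\tau}(a,b)}\right)^{\frac{t(1-t)}{\tau(1-\tau)}}\leq a\nabla b.$$ If instead $r(\tau)\leq t\leq R(\tau)$, then the reversed inequality ($\geq$) holds.
   Context: For $a,b>0$ and $0\le t\le 1$: $a!_t b=((1-t)a^{-1}+tb^{-1})^{-1}$ is the weighted harmonic mean, $a\nabla b=\frac{a+b}{2}$, and the harmonic Heinz mean is $!_t(a,b)=\frac{a!_tb+a!_{1-t}b}{2}$. For $0\le\tau\le1$, $r(\tau)=\min\{\tau,1-\tau\}$ and $R(\tau)=\max\{\tau,1-\tau\}$. *)

theory Defs
  imports Complex_Main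
begin

text \<open>The means are total functions on the reals; they carry their usual meaning for positive
  \<open>a\<close>, \<open>b\<close> and weights in \<open>[0, 1]\<close>, where no division by zero occurs.\<close>

definition weighted_harmonic_mean :: "real \<Rightarrow> real \<Rightarrow> real \<Rightarrow> real" where
  "weighted_harmonic_mean t a b = inverse ((1 - t) * inverse a + t * inverse b)"

definition arithmetic_mean :: "real \<Rightarrow> real \<Rightarrow> real" where
  "arithmetic_mean a b = (a + b) / 2"

definition harmonic_heinz_mean :: "real \<Rightarrow> real \<Rightarrow> real \<Rightarrow> real" where
  "harmonic_heinz_mean t a b =
     (weighted_harmonic_mean t a b + weighted_harmonic_mean (1 - t) a b) / 2"

definition min_weight :: "real \<Rightarrow> real" where
  "min_weight \<tau> = min \<tau> (1 - \<tau>)"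

definition max_weight :: "real \<Rightarrow> real" where
  "max_weight \<tau> = max \<tau> (1 - \<tau>)"

end

theory Submission
  imports Defs "HOL-Analysis.Convex"
begin

text \<open>
  With \<open>k = (a - b)\<^sup>2 / (a * b) \<ge> 0\<close> the two weighted harmonic means in the harmonic Heinz mean
  have a common numerator, and their sum collapses to the arithmetic mean divided by
  \<open>1 + t * (1 - t) * k\<close>. The weight thus enters only through \<open>s = t * (1 - t)\<close>; writing
  \<open>\<sigma> = \<tau> * (1 - \<tau>)\<close>, the quantity to be compared with the arithmetic mean is the arithmetic mean
  times \<open>(1 + \<sigma> * k) powr (s / \<sigma>) / (1 + s * k)\<close>. Bernoulli's inequality for real exponents
  says that this factor is at most 1 for \<open>s \<le> \<sigma>\<close> and at least 1 for \<open>s \<ge> \<sigma>\<close>. Finally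
  \<open>t \<mapsto> t * (1 - t)\<close> is symmetric about \<open>1/2\<close> and decreases with the distance to it, so
  \<open>s \<ge> \<sigma>\<close> means exactly that \<open>t\<close> lies between \<open>\<tau>\<close> and \<open>1 - \<tau>\<close>.
\<close>

lemma harmonic_heinz_mean_eq_arithmetic_mean_div:
  fixes a b t :: real
  assumes "0 < a" "0 < b" "0 < t" "t < 1"
  shows "harmonic_heinz_mean t a b =
           arithmetic_mean a b / (1 + t * (1 - t) * ((a - b)\<^sup>2 / (a * b)))"
proof -
  define P where "P = (1 - t) * b + t * a"
  define Q where "Q = t * b + (1 - t) * a"
  have "P > 0" "Q > 0"
    unfolding P_def Q_def using assms by (simp_all add: add_pos_pos)
  have P: "weighted_harmonic_mean t a b = a * b / P"
    unfolding weighted_harmonic_mean_def P_def using assms by (simp add: field_simps)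
  have Q: "weighted_harmonic_mean (1 - t) a b = a * b / Q"
    unfolding weighted_harmonic_mean_def Q_def using assms by (simp add: field_simps)
  have "P + Q = a + b"
    unfolding P_def Q_def by (simp add: algebra_simps)
  have PQ: "P * Q = a * b + t * (1 - t) * (a - b)\<^sup>2"
    unfolding P_def Q_def by (simp add: algebra_simps power2_eq_square)
  have "harmonic_heinz_mean t a b = a * b * (P + Q) / (2 * (P * Q))"
    unfolding harmonic_heinz_mean_def P Q using \<open>P > 0\<close> \<open>Q > 0\<close> by (simp add: field_simps)
  also have "\<dots> = arithmetic_mean a b / (P * Q / (a * b))"
    unfolding \<open>P + Q = a + b\<close> arithmetic_mean_def by simp
  also have "P * Q / (a * b) = 1 + t * (1 - t) * ((a - b)\<^sup>2 / (a * b))"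
    unfolding PQ using assms by (simp add: add_divide_distrib)
  finally show ?thesis .
qed

text \<open>
  Bernoulli's inequality \<open>(1 + x) powr p \<le> 1 + p * x\<close> for \<open>0 \<le> p \<le> 1\<close> is the weighted
  inequality between the geometric and the arithmetic mean of \<open>1 + x\<close> and \<open>1\<close> with weights
  \<open>p\<close> and \<open>1 - p\<close>. Taking \<open>p = s / \<sigma>\<close> and \<open>x = \<sigma> * k\<close> makes \<open>s\<close> and \<open>\<sigma>\<close> play dual roles, so
  that the case of exponents at least 1 follows by exchanging them.
\<close>

lemma Bernoulli_powr_quotient_le:
  fixes s \<sigma> k :: real
  assumes "0 < s" "s \<le> \<sigma>" "0 \<le> k"
  shows "(1 + \<sigma> * k) powr (s / \<sigma>) \<le> 1 + s * k"
proof -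
  have "(1 + \<sigma> * k) powr (s / \<sigma>) * 1 powr (1 - s / \<sigma>)
          \<le> s / \<sigma> * (1 + \<sigma> * k) + (1 - s / \<sigma>) * 1"
    using assms by (intro Youngs_inequality_0) (auto simp: add_pos_nonneg)
  also have "\<dots> = 1 + s * k"
    using assms by (simp add: field_simps)
  finally show ?thesis by simp
qed

lemma Bernoulli_powr_quotient_ge:
  fixes s \<sigma> k :: real
  assumes "0 < \<sigma>" "\<sigma> \<le> s" "0 \<le> k"
  shows "1 + s * k \<le> (1 + \<sigma> * k) powr (s / \<sigma>)"
proof -
  have pos: "1 + s * k > 0"
    using assms by (simp add: add_pos_nonneg)
  have "1 + s * k = ((1 + s * k) powr (\<sigma> / s)) powr (s / \<sigma>)"
    using assms pos by (simp add: powr_powr)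
  also have "\<dots> \<le> (1 + \<sigma> * k) powr (s / \<sigma>)"
    using assms by (intro powr_mono2 Bernoulli_powr_quotient_le) auto
  finally show ?thesis .
qed

lemma weight_product_diff:
  fixes t \<tau> :: real
  shows "t * (1 - t) - \<tau> * (1 - \<tau>) = (t - \<tau>) * (1 - \<tau> - t)"
  by (simp add: algebra_simps)

lemma weight_product_le_if_outside:
  assumes "t \<le> min_weight \<tau> \<or> t \<ge> max_weight \<tau>"
  shows "t * (1 - t) \<le> \<tau> * (1 - \<tau>)"
proof -
  have "(t - \<tau>) * (1 - \<tau> - t) \<le> 0"
    using assms by (auto simp: min_weight_def max_weight_def mult_le_0_iff)
  then show ?thesis
    using weight_product_diff[of t \<tau>] by linarith
qed

lemma weight_product_ge_if_between:
  assumes "min_weight \<tau> \<le> t" "t \<le> max_weight \<tau>"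
  shows "\<tau> * (1 - \<tau>) \<le> t * (1 - t)"
proof -
  have "0 \<le> (t - \<tau>) * (1 - \<tau> - t)"
    using assms
    by (auto simp: min_weight_def max_weight_def zero_le_mult_iff min_def max_def split: if_splits)
  then show ?thesis
    using weight_product_diff[of t \<tau>] by linarith
qed

theorem corollary2p6:
  fixes a b t \<tau> :: real
  assumes "0 < a" and "0 < b"
    and "0 < t" and "t < 1"
    and "0 < \<tau>" and "\<tau> < 1"
  shows "(t \<le> min_weight \<tau> \<or> t \<ge> max_weight \<tau> \<longrightarrow>
           harmonic_heinz_mean t a b *
             (arithmetic_mean a b / harmonic_heinz_mean \<tau> a b)
               powr (t * (1 - t) / (\<tau> * (1 - \<tau>)))
           \<le> arithmetic_mean a b) \<and>
         (min_weight \<tau> \<le> t \<and> t \<le> max_weight \<tau> \<longrightarrow>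
           harmonic_heinz_mean t a b *
             (arithmetic_mean a b / harmonic_heinz_mean \<tau> a b)
               powr (t * (1 - t) / (\<tau> * (1 - \<tau>)))
           \<ge> arithmetic_mean a b)"
proof -
  define s where "s = t * (1 - t)"
  define \<sigma> where "\<sigma> = \<tau> * (1 - \<tau>)"
  define k where "k = (a - b)\<^sup>2 / (a * b)"
  define A where "A = arithmetic_mean a b"
  have "0 < s" "0 < \<sigma>" "0 \<le> k" "0 < A"
    unfolding s_def \<sigma>_def k_def A_def arithmetic_mean_def using assms by simp_all
  have "0 < 1 + s * k" "0 < 1 + \<sigma> * k"
    using \<open>0 < s\<close> \<open>0 < \<sigma>\<close> \<open>0 \<le> k\<close> by (simp_all add: add_pos_nonneg)
  have Ht: "harmonic_heinz_mean t a b = A / (1 + s * k)"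
    and H\<tau>: "harmonic_heinz_mean \<tau> a b = A / (1 + \<sigma> * k)"
    unfolding A_def s_def \<sigma>_def k_def
    using assms by (simp_all only: harmonic_heinz_mean_eq_arithmetic_mean_div)
  have "A / harmonic_heinz_mean \<tau> a b = 1 + \<sigma> * k"
    unfolding H\<tau> using \<open>0 < A\<close> by simp
  then have product: "harmonic_heinz_mean t a b * (A / harmonic_heinz_mean \<tau> a b) powr (s / \<sigma>)
      = A * ((1 + \<sigma> * k) powr (s / \<sigma>) / (1 + s * k))"
    unfolding Ht by simp
  have le: "A * ((1 + \<sigma> * k) powr (s / \<sigma>) / (1 + s * k)) \<le> A" if "s \<le> \<sigma>"
    using Bernoulli_powr_quotient_le[OF \<open>0 < s\<close> that \<open>0 \<le> k\<close>] \<open>0 < A\<close> \<open>0 < 1 + s * k\<close>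
    by (simp add: pos_divide_le_eq)
  have ge: "A \<le> A * ((1 + \<sigma> * k) powr (s / \<sigma>) / (1 + s * k))" if "\<sigma> \<le> s"
    using Bernoulli_powr_quotient_ge[OF \<open>0 < \<sigma>\<close> that \<open>0 \<le> k\<close>] \<open>0 < A\<close> \<open>0 < 1 + s * k\<close>
    by (simp add: pos_le_divide_eq)
  show ?thesis
    using le ge weight_product_le_if_outside[of t \<tau>] weight_product_ge_if_between[of \<tau> t]
    unfolding A_def[symmetric] s_def[symmetric] \<sigma>_def[symmetric] product by blast
qed

end
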